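(* Let $I\subseteq (K[X,Y],(q_1,q_2))$ be a monomial ideal minimally generated in degrees $d_1<d_2<\cdots<d_r$ such that the monomials of $I_{d_i}$ form a lexsegment for all $i=1,\ldots,r$. For each $i$ with $q_1\nmid d_i$ let $\delta_i$ be the smallest integer of the form $d_i+\beta q_2$, $\beta\in\mathbb N$, which is divisible by $q_1$. Then $I$ is a lexicographic ideal if and only if either $q_1\mid d_1$, or $q_1\nmid d_1$ and there exists $1<s\le r$ such that $q_1\mid d_s$ and $d_s\le\min\{\delta_i\}$, the minimum being over all $i$ with $q_1\nmid d_i$.
   Context: $K$ is an infinite field of characteristic $0$ and $K[X,Y]$ is graded by $\deg X=q_1$, $\deg Y=q_2$, where $0<q_1<q_2$ are coprime integers. "Minimally generated in degrees $d_1<\cdots<d_r$" means that $\{d_1,\ldots,d_r\}$ is the set of degrees of the minimal monomial generators of $I$. Monomials of the same degree are compared lexicographically with $X>Y$: $X^aY^b>X^{a'}Y^{b'}$ iff $a>a'$. A lexsegment of degree $d$ is a set $L$ of monomials of degree $d$ such that $u\in L$, $v>u$, $\deg v=\deg u$ imply $v\in L$. A monomial ideal is lexicographic if each of its graded components is spanned as a $K$-vector space by a (possibly empty) lexsegment. *)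

theory Defs
  imports Complex_Main "HOL-Library.Poly_Mapping" "HOL-Library.Product_Plus"
begin

text \<open>The polynomial ring \<open>K[X,Y]\<close> is the monoid algebra of \<open>\<nat> \<times> \<nat>\<close>, whose ring structure
  (convolution) is the library's; the pair \<open>(a, b)\<close> stands for the monomial \<open>X^a Y^b\<close>.\<close>

type_synonym 'k bipoly = "(nat \<times> nat) \<Rightarrow>\<^sub>0 'k"

definition xymonom :: "nat \<times> nat \<Rightarrow> 'k::field bipoly" where
  "xymonom m = Poly_Mapping.single m 1"

definition cscale :: "'k::field \<Rightarrow> 'k bipoly \<Rightarrow> 'k bipoly" where
  "cscale c p = Poly_Mapping.single 0 c * p"

text \<open>The library constants \<open>module.subspace\<close> and \<open>module.span\<close> are applied below to two module
  structures on \<open>K[X,Y]\<close>: over itself they give ideals and generated ideals, over \<open>K\<close> they give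
  linear subspaces and linear spans.\<close>

lemma module_self: "module ((*) :: 'k::field bipoly \<Rightarrow> 'k bipoly \<Rightarrow> 'k bipoly)"
  by unfold_locales (simp_all add: algebra_simps)

lemma vector_space_cscale: "vector_space (cscale :: 'k::field \<Rightarrow> 'k bipoly \<Rightarrow> 'k bipoly)"
  by unfold_locales
    (simp_all add: cscale_def algebra_simps single_add mult_single flip: mult.assoc)

definition ideal_generated :: "'k::field bipoly set \<Rightarrow> 'k bipoly set" where
  "ideal_generated S = module.span (*) S"

definition monomial_ideal :: "'k::field bipoly set \<Rightarrow> bool" where
  "monomial_ideal I \<longleftrightarrow> (\<exists>S. I = ideal_generated (xymonom ` S))"

definition minimal_monomial_generators ::
    "'k::field bipoly set \<Rightarrow> (nat \<times> nat) set \<Rightarrow> bool" where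
  "minimal_monomial_generators I G \<longleftrightarrow>
     ideal_generated (xymonom ` G) = I \<and> (\<forall>G'. G' \<subset> G \<longrightarrow> ideal_generated (xymonom ` G') \<noteq> I)"

definition wdeg :: "nat \<Rightarrow> nat \<Rightarrow> nat \<times> nat \<Rightarrow> nat" where
  "wdeg q1 q2 m = q1 * fst m + q2 * snd m"

text \<open>A monomial ideal has exactly one minimal set \<open>G\<close> of monomial generators, so the existential
  quantifier only gives that set a name.\<close>

definition minimally_generated_in_degrees ::
    "nat \<Rightarrow> nat \<Rightarrow> 'k::field bipoly set \<Rightarrow> nat set \<Rightarrow> bool" where
  "minimally_generated_in_degrees q1 q2 I D \<longleftrightarrow>
     (\<exists>G. minimal_monomial_generators I G \<and> wdeg q1 q2 ` G = D)"

definition graded_component ::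
    "nat \<Rightarrow> nat \<Rightarrow> 'k::field bipoly set \<Rightarrow> nat \<Rightarrow> 'k bipoly set" where
  "graded_component q1 q2 I n = {p \<in> I. \<forall>m \<in> Poly_Mapping.keys p. wdeg q1 q2 m = n}"

text \<open>The order is only used to compare monomials of equal degree.\<close>

definition lex_greater :: "nat \<times> nat \<Rightarrow> nat \<times> nat \<Rightarrow> bool" where
  "lex_greater u v \<longleftrightarrow> fst u > fst v"

definition lexsegment :: "nat \<Rightarrow> nat \<Rightarrow> nat \<Rightarrow> (nat \<times> nat) set \<Rightarrow> bool" where
  "lexsegment q1 q2 n L \<longleftrightarrow>
     L \<subseteq> {m. wdeg q1 q2 m = n} \<and>
     (\<forall>u v. u \<in> L \<and> lex_greater v u \<and> wdeg q1 q2 v = wdeg q1 q2 u \<longrightarrow> v \<in> L)"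

definition lexicographic_ideal :: "nat \<Rightarrow> nat \<Rightarrow> 'k::field bipoly set \<Rightarrow> bool" where
  "lexicographic_ideal q1 q2 I \<longleftrightarrow>
     monomial_ideal I \<and>
     (\<forall>n. \<exists>L. lexsegment q1 q2 n L \<and> graded_component q1 q2 I n = module.span cscale (xymonom ` L))"

text \<open>\<open>delta q1 q2 n\<close> is the paper's \<open>\<delta>\<^sub>i\<close> for \<open>n = d\<^sub>i\<close>; the least element exists for coprime
  \<open>q1\<close>, \<open>q2\<close>.\<close>

definition delta :: "nat \<Rightarrow> nat \<Rightarrow> nat \<Rightarrow> nat" where
  "delta q1 q2 n = (LEAST e. (\<exists>\<beta>. e = n + \<beta> * q2) \<and> q1 dvd e)"

end

theory Submission
  imports Defs
begin

text \<open>
  Since \<open>I\<close> is a monomial ideal, it is determined by the set \<open>M\<close> of exponents of its monomials, which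
  is the set of multiples of any set \<open>G\<close> of monomial generators, and \<open>I\<close> is lexicographic precisely
  when \<open>M\<close> is closed under passing to lexicographically larger monomials of the same degree.

  As \<open>q\<^sub>1\<close> and \<open>q\<^sub>2\<close> are coprime, every such passage is a sequence of exchanges of \<open>Y^q\<^sub>1\<close> for
  \<open>X^q\<^sub>2\<close>. Suppose that a multiple \<open>u\<close> of a generator \<open>g = X^a Y^b\<close> is divisible by \<open>Y^q\<^sub>1\<close>. If
  \<open>b \<ge> q\<^sub>1\<close>, the exchange can be made in \<open>g\<close> itself, whose degree is one of the \<open>d\<^sub>i\<close>, and the
  lexsegment hypothesis applies. If \<open>b = 0\<close>, the exchange keeps \<open>u\<close> a multiple of \<open>g\<close>. Only
  the case \<open>0 < b < q\<^sub>1\<close> can fail; there the first exchange occurs in \<open>X^a Y^q\<^sub>1\<close> and produces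
  \<open>X^(a+q\<^sub>2)\<close>, the power of \<open>X\<close> of degree \<open>\<delta>\<^sub>i\<close>, where \<open>d\<^sub>i = deg g\<close>. If \<open>b > q\<^sub>1\<close> is not
  divisible by \<open>q\<^sub>1\<close>, repeated exchanges also end in the power of \<open>X\<close> of degree \<open>\<delta>\<^sub>i\<close>. Hence \<open>I\<close> is
  lexicographic iff, for every \<open>d\<^sub>i\<close> not divisible by \<open>q\<^sub>1\<close>, it contains the power of \<open>X\<close> of
  degree \<open>\<delta>\<^sub>i\<close> (lemma \<open>exchange_closed_iff_delta_powers\<close>).

  It remains to see which powers of \<open>X\<close> lie in \<open>I\<close>. The largest monomial of a degree divisible by \<open>q\<^sub>1\<close> is
  a power of \<open>X\<close>, so by the lexsegment hypothesis every \<open>d\<^sub>s\<close> divisible by \<open>q\<^sub>1\<close> contributes the power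
  of \<open>X\<close> of degree \<open>d\<^sub>s\<close>; conversely the generator that divides a power of \<open>X\<close> is itself one and
  has a degree \<open>d\<^sub>s\<close> divisible by \<open>q\<^sub>1\<close>. So \<open>I\<close> is lexicographic iff some such \<open>d\<^sub>s\<close> is at most
  every \<open>\<delta>\<^sub>i\<close>, which is automatic when \<open>s = 1\<close>, because \<open>d\<^sub>1 \<le> d\<^sub>i \<le> \<delta>\<^sub>i\<close>.
\<close>

section \<open>Monomial ideals and their exponents\<close>

definition multiples :: "'a::plus set \<Rightarrow> 'a set" where
  "multiples G = {g + k | g k. g \<in> G}"

lemma multiples_add: "m \<in> multiples G \<Longrightarrow> m + k \<in> multiples G" for m :: "'a::semigroup_add"
  by (auto simp: multiples_def) (metis add.assoc)

lemma multiples_base: "g \<in> G \<Longrightarrow> g \<in> multiples G" for g :: "'a::monoid_add"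
  by (force simp: multiples_def intro: exI[of _ 0])

lemma multiples_mono:
  fixes G :: "(nat \<times> nat) set"
  assumes "(a, b) \<in> multiples G" "a \<le> a'" "b \<le> b'"
  shows "(a', b') \<in> multiples G"
  using multiples_add[OF assms(1), of "(a' - a, b' - b)"] assms(2,3) by simp

lemma in_multiplesE:
  fixes G :: "(nat \<times> nat) set"
  assumes "(a, b) \<in> multiples G"
  obtains a0 b0 where "(a0, b0) \<in> G" "a0 \<le> a" "b0 \<le> b"
  using assms by (fastforce simp: multiples_def)

lemma sum_terms_poly_mapping:
  "(\<Sum>m\<in>Poly_Mapping.keys p. Poly_Mapping.single m (Poly_Mapping.lookup p m)) = p"
  for p :: "'a \<Rightarrow>\<^sub>0 'b::comm_monoid_add"
proof (rule poly_mapping_eqI)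
  fix k
  show "Poly_Mapping.lookup
      (\<Sum>m\<in>Poly_Mapping.keys p. Poly_Mapping.single m (Poly_Mapping.lookup p m)) k =
    Poly_Mapping.lookup p k"
    by (simp add: lookup_sum lookup_single when_def in_keys_iff)
qed

lemma cscale_xymonom: "cscale c (xymonom m) = Poly_Mapping.single m c"
  by (simp add: cscale_def xymonom_def mult_single)

lemma span_xymonom:
  "module.span cscale (xymonom ` L) = {p :: 'k::field bipoly. Poly_Mapping.keys p \<subseteq> L}"
proof -
  interpret K: vector_space "cscale :: 'k \<Rightarrow> 'k bipoly \<Rightarrow> 'k bipoly"
    by (rule vector_space_cscale)
  show ?thesis
  proof
    show "K.span (xymonom ` L) \<subseteq> {p. Poly_Mapping.keys p \<subseteq> L}"
    proof (rule K.span_minimal)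
      show "K.subspace {p. Poly_Mapping.keys p \<subseteq> L}"
      proof (rule K.subspaceI)
        fix c :: 'k and p :: "'k bipoly"
        assume "p \<in> {p. Poly_Mapping.keys p \<subseteq> L}"
        moreover have "Poly_Mapping.keys (cscale c p) \<subseteq> Poly_Mapping.keys p"
        proof
          fix m assume "m \<in> Poly_Mapping.keys (cscale c p)"
          then obtain k m' where "m = k + m'" "k \<in> Poly_Mapping.keys (Poly_Mapping.single 0 c)"
            "m' \<in> Poly_Mapping.keys p"
            using keys_mult[of "Poly_Mapping.single 0 c" p] unfolding cscale_def by blast
          then show "m \<in> Poly_Mapping.keys p" by (simp split: if_splits)
        qed
        ultimately show "cscale c p \<in> {p. Poly_Mapping.keys p \<subseteq> L}" by blast
      qed (use keys_add in force)+
    qed (auto simp: xymonom_def)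
    show "{p. Poly_Mapping.keys p \<subseteq> L} \<subseteq> K.span (xymonom ` L)"
    proof
      fix p :: "'k bipoly" assume "p \<in> {p. Poly_Mapping.keys p \<subseteq> L}"
      then have "(\<Sum>m\<in>Poly_Mapping.keys p. cscale (Poly_Mapping.lookup p m) (xymonom m))
          \<in> K.span (xymonom ` L)"
        by (intro K.span_sum K.span_scale K.span_base) auto
      then show "p \<in> K.span (xymonom ` L)"
        by (simp add: cscale_xymonom sum_terms_poly_mapping)
    qed
  qed
qed

lemma ideal_generated_xymonom:
  "ideal_generated (xymonom ` G) = {p :: 'k::field bipoly. Poly_Mapping.keys p \<subseteq> multiples G}"
proof -
  interpret R: module "(*) :: 'k bipoly \<Rightarrow> 'k bipoly \<Rightarrow> 'k bipoly"
    by (rule module_self)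
  show ?thesis
    unfolding ideal_generated_def
  proof
    show "R.span (xymonom ` G) \<subseteq> {p. Poly_Mapping.keys p \<subseteq> multiples G}"
    proof (rule R.span_minimal)
      show "R.subspace {p. Poly_Mapping.keys p \<subseteq> multiples G}"
      proof (rule R.subspaceI)
        fix c p :: "'k bipoly"
        assume p: "p \<in> {p. Poly_Mapping.keys p \<subseteq> multiples G}"
        have "a + b \<in> multiples G" if "b \<in> Poly_Mapping.keys p" for a b
          using p that multiples_add[of b G a] by (auto simp only: add.commute)
        then show "c * p \<in> {p. Poly_Mapping.keys p \<subseteq> multiples G}"
          using keys_mult[of c p] by blast
      qed (use keys_add in force)+
    qed (auto simp: xymonom_def multiples_base)
    show "{p. Poly_Mapping.keys p \<subseteq> multiples G} \<subseteq> R.span (xymonom ` G)"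
    proof
      fix p :: "'k bipoly" assume p: "p \<in> {p. Poly_Mapping.keys p \<subseteq> multiples G}"
      have "Poly_Mapping.single m (Poly_Mapping.lookup p m) \<in> R.span (xymonom ` G)"
        if m: "m \<in> Poly_Mapping.keys p" for m
      proof -
        from p m have "m \<in> multiples G" by blast
        then obtain g k where "g \<in> G" and m: "m = g + k"
          unfolding multiples_def by blast
        then have "Poly_Mapping.single k (Poly_Mapping.lookup p m) * xymonom g
            \<in> R.span (xymonom ` G)"
          by (intro R.span_scale R.span_base) auto
        then show ?thesis
          by (simp add: xymonom_def mult_single m add.commute)
      qed
      then have "(\<Sum>m\<in>Poly_Mapping.keys p. Poly_Mapping.single m (Poly_Mapping.lookup p m))
          \<in> R.span (xymonom ` G)"
        by (rule R.span_sum)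
      then show "p \<in> R.span (xymonom ` G)"
        by (simp only: sum_terms_poly_mapping)
    qed
  qed
qed

text \<open>A span of monomials determines the set of monomials spanning it, so the only lexsegment that
  can span a graded component is the set of all monomials of that component.\<close>

lemma lexicographic_ideal_iff:
  assumes G: "I = ideal_generated (xymonom ` G :: 'k::field bipoly set)"
  shows "lexicographic_ideal q1 q2 I \<longleftrightarrow>
    (\<forall>u v. u \<in> multiples G \<and> lex_greater v u \<and> wdeg q1 q2 v = wdeg q1 q2 u \<longrightarrow> v \<in> multiples G)"
proof -
  have comp: "graded_component q1 q2 I n =
      module.span cscale (xymonom ` {m \<in> multiples G. wdeg q1 q2 m = n})" for n
    by (auto simp: graded_component_def span_xymonom G ideal_generated_xymonom)
  have uniq: "L = L'" if "module.span cscale (xymonom ` L) = module.span cscale (xymonom ` L' :: 'k bipoly set)"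
    for L L'
  proof -
    have "Poly_Mapping.keys (xymonom m :: 'k bipoly) = {m}" for m
      by (simp add: xymonom_def)
    moreover have "Poly_Mapping.keys p \<subseteq> L \<longleftrightarrow> Poly_Mapping.keys p \<subseteq> L'" for p :: "'k bipoly"
      using that by (auto simp: span_xymonom)
    ultimately have "{m} \<subseteq> L \<longleftrightarrow> {m} \<subseteq> L'" for m
      by metis
    then show ?thesis by auto
  qed
  have seg: "(\<exists>L. lexsegment q1 q2 n L \<and> graded_component q1 q2 I n = module.span cscale (xymonom ` L)) \<longleftrightarrow>
      lexsegment q1 q2 n {m \<in> multiples G. wdeg q1 q2 m = n}" for n
    unfolding comp by (auto dest: uniq)
  show ?thesis
    using G unfolding lexicographic_ideal_def monomial_ideal_def seg unfolding lexsegment_def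
    by blast
qed

section \<open>Lexicographic comparison in a fixed degree\<close>

lemma lex_greater_same_degreeE:
  assumes "0 < q1" "coprime q1 q2" "lex_greater v u" "wdeg q1 q2 v = wdeg q1 q2 u"
  obtains t where "fst v = fst u + t * q2" "snd u = snd v + t * q1"
proof -
  define i where "i = fst v - fst u"
  have i: "fst v = fst u + i" "0 < i"
    using assms(3) by (auto simp: i_def lex_greater_def)
  have deg: "q1 * i + q2 * snd v = q2 * snd u"
    using assms(4) by (simp add: wdeg_def i algebra_simps)
  have "q2 dvd q1 * i"
    by (metis deg dvd_add_left_iff dvd_triv_left)
  then have "q2 dvd i"
    using assms(2) by (simp add: coprime_commute coprime_dvd_mult_right_iff)
  then obtain t where t: "i = t * q2"
    by (metis dvd_div_mult_self)
  with i have "0 < q2" by auto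
  moreover have "q2 * (snd v + t * q1) = q2 * snd u"
    using deg t by (simp add: algebra_simps)
  ultimately have "snd u = snd v + t * q1" by simp
  with i t that show thesis by blast
qed

lemma lex_closed_iff_exchange_closed:
  assumes "0 < q1" "0 < q2" "coprime q1 q2"
  shows "(\<forall>u v. u \<in> M \<and> lex_greater v u \<and> wdeg q1 q2 v = wdeg q1 q2 u \<longrightarrow> v \<in> M) \<longleftrightarrow>
    (\<forall>a b. (a, b + q1) \<in> M \<longrightarrow> (a + q2, b) \<in> M)" (is "?lex \<longleftrightarrow> ?exch")
proof
  assume lex: ?lex
  show ?exch
  proof (intro allI impI)
    fix a b assume "(a, b + q1) \<in> M"
    moreover have "lex_greater (a + q2, b) (a, b + q1)"
      "wdeg q1 q2 (a + q2, b) = wdeg q1 q2 (a, b + q1)"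
      using assms by (auto simp: lex_greater_def wdeg_def algebra_simps)
    ultimately show "(a + q2, b) \<in> M" using lex by blast
  qed
next
  assume exch: ?exch
  have iter: "(a + t * q2, b) \<in> M" if "(a, b + t * q1) \<in> M" for a b t
    using that
  proof (induction t arbitrary: a)
    case (Suc t)
    have "(a, (b + t * q1) + q1) \<in> M" using Suc.prems by (simp add: algebra_simps)
    with exch have "(a + q2, b + t * q1) \<in> M" by blast
    then show ?case using Suc.IH[of "a + q2"] by (simp add: algebra_simps)
  qed simp
  show ?lex
  proof (intro allI impI)
    fix u v assume uv: "u \<in> M \<and> lex_greater v u \<and> wdeg q1 q2 v = wdeg q1 q2 u"
    then obtain t where "fst v = fst u + t * q2" "snd u = snd v + t * q1"
      using lex_greater_same_degreeE assms by metis
    then show "v \<in> M"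
      using uv iter[of "fst u" "snd v" t] by (metis prod.collapse)
  qed
qed

lemma dvd_wdeg_iff:
  assumes "coprime q1 q2"
  shows "q1 dvd wdeg q1 q2 (a, b) \<longleftrightarrow> q1 dvd b"
  using assms by (simp add: wdeg_def dvd_add_right_iff coprime_dvd_mult_right_iff)

text \<open>The largest monomial of a degree divisible by \<open>q\<^sub>1\<close> is a power of \<open>X\<close>.\<close>

lemma lexsegment_contains_X_power:
  assumes "0 < q1" "0 < q2" "coprime q1 q2"
    and seg: "lexsegment q1 q2 (q1 * e) L" and "m \<in> L"
  shows "(e, 0) \<in> L"
proof -
  obtain a b where m: "m = (a, b)" by fastforce
  have deg: "q1 * a + q2 * b = q1 * e"
    using seg \<open>m \<in> L\<close> by (auto simp: lexsegment_def wdeg_def m)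
  show ?thesis
  proof (cases "b = 0")
    case True
    with deg \<open>0 < q1\<close> \<open>m \<in> L\<close> show ?thesis by (simp add: m)
  next
    case False
    then have "q1 * a < q1 * e" using deg \<open>0 < q2\<close> by (metis less_add_same_cancel1 nat_0_less_mult_iff neq0_conv)
    then have "lex_greater (e, 0) m" by (simp add: lex_greater_def m)
    moreover have "wdeg q1 q2 (e, 0) = wdeg q1 q2 m"
      using deg by (simp add: wdeg_def m)
    ultimately show ?thesis
      using seg \<open>m \<in> L\<close> unfolding lexsegment_def by blast
  qed
qed

section \<open>The degrees \<open>\<delta>\<close>\<close>

text \<open>Multiplication by \<open>Y\<close> raises the degree by \<open>q\<^sub>2\<close>, so \<open>\<delta>\<close> is reached when the \<open>Y\<close>-exponent is
  rounded up to the next multiple of \<open>q\<^sub>1\<close>; \<open>\<delta>\<close> is then the degree of the power of \<open>X\<close> to which all of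
  \<open>Y\<close> has been exchanged.\<close>

lemma delta_wdeg:
  assumes "0 < q1" "coprime q1 q2" and b: "\<not> q1 dvd b"
  shows "delta q1 q2 (wdeg q1 q2 (a, b)) = q1 * (a + (b div q1 + 1) * q2)"
  unfolding delta_def
proof (rule Least_equality)
  have less: "b mod q1 < q1" using \<open>0 < q1\<close> by simp
  define r where "r = q1 - b mod q1"
  have round_up: "(b div q1 + 1) * q1 = b + r"
    using less div_mult_mod_eq[of b q1] unfolding r_def distrib_right by linarith
  have "q1 * (a + (b div q1 + 1) * q2) = q1 * a + ((b div q1 + 1) * q1) * q2"
    by (simp add: algebra_simps)
  also have "\<dots> = wdeg q1 q2 (a, b) + r * q2"
    unfolding round_up by (simp add: wdeg_def algebra_simps)
  finally have "q1 * (a + (b div q1 + 1) * q2) = wdeg q1 q2 (a, b) + r * q2" .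
  then show "(\<exists>\<beta>. q1 * (a + (b div q1 + 1) * q2) = wdeg q1 q2 (a, b) + \<beta> * q2) \<and>
      q1 dvd q1 * (a + (b div q1 + 1) * q2)" using dvd_triv_left by blast
next
  fix e assume "(\<exists>\<beta>. e = wdeg q1 q2 (a, b) + \<beta> * q2) \<and> q1 dvd e"
  then obtain \<beta> where e: "e = wdeg q1 q2 (a, b + \<beta>)" and "q1 dvd e"
    by (auto simp: wdeg_def algebra_simps)
  then have "q1 dvd b + \<beta>" using dvd_wdeg_iff \<open>coprime q1 q2\<close> by blast
  then obtain t where t: "b + \<beta> = q1 * t" by blast
  have "b div q1 * q1 \<noteq> b" using b by (metis dvd_triv_right)
  then have "b div q1 * q1 < b" using div_times_less_eq_dividend[of b q1] by linarith
  then have "q1 * (b div q1) < q1 * t" using t by (metis le_add1 mult.commute order_less_le_trans)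
  then have "b div q1 + 1 \<le> t" by simp
  then have "q1 * (a + (b div q1 + 1) * q2) \<le> q1 * (a + t * q2)"
    by (intro mult_le_mono add_le_mono le_refl)
  also have "\<dots> = e" unfolding e wdeg_def fst_conv snd_conv t by (simp add: algebra_simps)
  finally show "q1 * (a + (b div q1 + 1) * q2) \<le> e" .
qed

text \<open>Only the \<open>Y\<close>-exponents strictly between \<open>0\<close> and \<open>q\<^sub>1\<close> produce an exchange that is neither made inside
  the generator nor absorbed by it; the power of \<open>X\<close> required there is the one of degree \<open>\<delta>\<close>. For larger
  \<open>Y\<close>-exponents that power is reached by repeated exchanges, so the condition may be asked of all
  generators uniformly.\<close>

lemma exchange_closed_iff_delta_powers:
  assumes "0 < q1" "0 < q2" "coprime q1 q2"
    and seg: "\<And>g. g \<in> G \<Longrightarrow>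
      lexsegment q1 q2 (wdeg q1 q2 g) {m \<in> multiples G. wdeg q1 q2 m = wdeg q1 q2 g}"
  shows "(\<forall>a b. (a, b + q1) \<in> multiples G \<longrightarrow> (a + q2, b) \<in> multiples G) \<longleftrightarrow>
    (\<forall>g\<in>G. \<not> q1 dvd wdeg q1 q2 g \<longrightarrow>
      (delta q1 q2 (wdeg q1 q2 g) div q1, 0) \<in> multiples G)" (is "?exch \<longleftrightarrow> ?powers")
proof
  assume exch: ?exch
  show ?powers
  proof (intro ballI impI)
    fix g assume "g \<in> G" and ndvd: "\<not> q1 dvd wdeg q1 q2 g"
    obtain a b where g: "g = (a, b)" by fastforce
    have b: "\<not> q1 dvd b" using ndvd dvd_wdeg_iff assms(3) g by blast
    define t where "t = b div q1 + 1"
    have "b \<le> t * q1"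
      using \<open>0 < q1\<close> dividend_less_div_times[of q1 b] by (simp add: t_def)
    then have "(a, t * q1) \<in> multiples G"
      using multiples_mono multiples_base \<open>g \<in> G\<close> g by blast
    \<comment> \<open>All of \<open>Y\<close> is exchanged at once, through the equivalent order-theoretic condition.\<close>
    moreover have "lex_greater (a + t * q2, 0) (a, t * q1)"
      "wdeg q1 q2 (a + t * q2, 0) = wdeg q1 q2 (a, t * q1)"
      using \<open>0 < q2\<close> by (simp_all add: lex_greater_def wdeg_def t_def algebra_simps)
    ultimately have "(a + t * q2, 0) \<in> multiples G"
      using exch lex_closed_iff_exchange_closed[OF assms(1-3), of "multiples G"] by blast
    moreover have "delta q1 q2 (wdeg q1 q2 g) = q1 * (a + t * q2)"
      unfolding g t_def using assms b by (intro delta_wdeg)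
    ultimately show "(delta q1 q2 (wdeg q1 q2 g) div q1, 0) \<in> multiples G"
      using \<open>0 < q1\<close> by simp
  qed
next
  assume powers: ?powers
  show ?exch
  proof (intro allI impI)
    fix a b assume "(a, b + q1) \<in> multiples G"
    then obtain a0 b0 where g: "(a0, b0) \<in> G" and le: "a0 \<le> a" "b0 \<le> b + q1"
      by (rule in_multiplesE)
    consider "q1 \<le> b0" | "b0 = 0" | "0 < b0" "b0 < q1" by linarith
    then show "(a + q2, b) \<in> multiples G"
    proof cases
      case 1
      let ?v = "(a0 + q2, b0 - q1)"
      have "wdeg q1 q2 ?v = wdeg q1 q2 (a0, b0)"
        using 1 by (auto simp: wdeg_def algebra_simps dest!: le_Suc_ex)
      moreover have "lex_greater ?v (a0, b0)"
        using \<open>0 < q2\<close> by (simp add: lex_greater_def)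
      ultimately have "?v \<in> multiples G"
        using seg[OF g] multiples_base[OF g] unfolding lexsegment_def by blast
      then show ?thesis
        by (rule multiples_mono) (use le in auto)
    next
      case 2
      then show ?thesis
        by (intro multiples_mono[OF multiples_base[OF g]]) (use le in auto)
    next
      case 3
      then have b0: "\<not> q1 dvd b0" by (auto dest: dvd_imp_le)
      then have "delta q1 q2 (wdeg q1 q2 (a0, b0)) = q1 * (a0 + q2)"
        using delta_wdeg[OF assms(1,3) b0] 3 by simp
      moreover have "\<not> q1 dvd wdeg q1 q2 (a0, b0)"
        using b0 dvd_wdeg_iff assms(3) by blast
      ultimately have "(a0 + q2, 0) \<in> multiples G"
        using powers g \<open>0 < q1\<close> by fastforce
      then show ?thesis
        by (rule multiples_mono) (use le in auto)
    qed
  qed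
qed

section \<open>Powers of \<open>X\<close> and the characterization\<close>

lemma X_power_in_multiples_iff:
  assumes "0 < q1" "0 < q2" "coprime q1 q2"
    and seg: "\<And>g. g \<in> G \<Longrightarrow>
      lexsegment q1 q2 (wdeg q1 q2 g) {m \<in> multiples G. wdeg q1 q2 m = wdeg q1 q2 g}"
  shows "(e, 0) \<in> multiples G \<longleftrightarrow>
    (\<exists>n \<in> wdeg q1 q2 ` G. q1 dvd n \<and> n \<le> q1 * e)"
proof
  assume "(e, 0) \<in> multiples G"
  then obtain c where "(c, 0) \<in> G" "c \<le> e" by (auto elim: in_multiplesE)
  then show "\<exists>n \<in> wdeg q1 q2 ` G. q1 dvd n \<and> n \<le> q1 * e"
    by (intro bexI[of _ "wdeg q1 q2 (c, 0)"] imageI) (auto simp: wdeg_def)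
next
  assume "\<exists>n \<in> wdeg q1 q2 ` G. q1 dvd n \<and> n \<le> q1 * e"
  then obtain g c where g: "g \<in> G" and c: "wdeg q1 q2 g = q1 * c" "q1 * c \<le> q1 * e"
    by (metis dvdE imageE)
  have "(c, 0) \<in> {m \<in> multiples G. wdeg q1 q2 m = wdeg q1 q2 g}"
    by (rule lexsegment_contains_X_power[OF assms(1-3)])
      (use seg[OF g] c(1) multiples_base[OF g] in auto)
  then show "(e, 0) \<in> multiples G"
    using multiples_mono[of c 0 G e 0] c(2) \<open>0 < q1\<close> by simp
qed

text \<open>Multiplying \<open>X^a Y^b\<close> by \<open>Y\<close> a further \<open>b (q\<^sub>1 - 1)\<close> times gives \<open>X^a Y^(b q\<^sub>1)\<close>, so in the degree of
  a monomial the least element defining \<open>\<delta>\<close> exists.\<close>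

lemma delta_wdeg_props:
  assumes "0 < q1"
  shows "q1 dvd delta q1 q2 (wdeg q1 q2 g)" and "wdeg q1 q2 g \<le> delta q1 q2 (wdeg q1 q2 g)"
proof -
  obtain a b where g: "g = (a, b)" by fastforce
  obtain k where k: "q1 = Suc k" using \<open>0 < q1\<close> gr0_conv_Suc by blast
  have "wdeg q1 q2 g + (b * k) * q2 = q1 * (a + b * q2)"
    by (simp add: g wdeg_def k algebra_simps)
  then have "\<exists>e. (\<exists>\<beta>. e = wdeg q1 q2 g + \<beta> * q2) \<and> q1 dvd e"
    by (metis dvd_triv_left)
  then have "(\<exists>\<beta>. delta q1 q2 (wdeg q1 q2 g) = wdeg q1 q2 g + \<beta> * q2) \<and>
      q1 dvd delta q1 q2 (wdeg q1 q2 g)"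
    unfolding delta_def by (rule LeastI_ex)
  then show "q1 dvd delta q1 q2 (wdeg q1 q2 g)" "wdeg q1 q2 g \<le> delta q1 q2 (wdeg q1 q2 g)"
    by auto
qed

lemma lexicographic_iff_delta_bounds:
  fixes I :: "'k::field bipoly set"
  assumes q: "0 < q1" "0 < q2" "coprime q1 q2"
    and I: "ideal_generated (xymonom ` G) = I"
    and seg: "\<And>n. n \<in> wdeg q1 q2 ` G \<Longrightarrow>
      lexsegment q1 q2 n {m. xymonom m \<in> graded_component q1 q2 I n}"
  shows "lexicographic_ideal q1 q2 I \<longleftrightarrow>
    (\<forall>n \<in> wdeg q1 q2 ` G. \<not> q1 dvd n \<longrightarrow>
      (\<exists>n' \<in> wdeg q1 q2 ` G. q1 dvd n' \<and> n' \<le> delta q1 q2 n))"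
proof -
  have "{m. xymonom m \<in> graded_component q1 q2 I n} = {m \<in> multiples G. wdeg q1 q2 m = n}" for n
    unfolding graded_component_def I[symmetric] ideal_generated_xymonom
    by (auto simp: xymonom_def)
  then have segG: "lexsegment q1 q2 (wdeg q1 q2 g) {m \<in> multiples G. wdeg q1 q2 m = wdeg q1 q2 g}"
    if "g \<in> G" for g
    using seg that by auto
  have "lexicographic_ideal q1 q2 I \<longleftrightarrow>
      (\<forall>g\<in>G. \<not> q1 dvd wdeg q1 q2 g \<longrightarrow> (delta q1 q2 (wdeg q1 q2 g) div q1, 0) \<in> multiples G)"
    unfolding lexicographic_ideal_iff[OF I[symmetric]] lex_closed_iff_exchange_closed[OF q]
    by (rule exchange_closed_iff_delta_powers[OF q segG])
  then show ?thesis
    using X_power_in_multiples_iff[OF q segG] delta_wdeg_props(1)[OF q(1)] by simp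
qed

theorem theorem4p11:
  fixes q1 q2 r :: nat
    and d :: "nat \<Rightarrow> nat"
    and I :: "'k::field_char_0 bipoly set"
  assumes "0 < q1" and "q1 < q2" and "coprime q1 q2"
    and "monomial_ideal I"
    and "1 \<le> r" and "strict_mono_on {1..r} d"
    and "minimally_generated_in_degrees q1 q2 I (d ` {1..r})"
    and "\<forall>i\<in>{1..r}. lexsegment q1 q2 (d i) {m. xymonom m \<in> graded_component q1 q2 I (d i)}"
  shows "lexicographic_ideal q1 q2 I \<longleftrightarrow>
    (q1 dvd d 1 \<or>
     (\<not> q1 dvd d 1 \<and>
      (\<exists>s. 1 < s \<and> s \<le> r \<and> q1 dvd d s \<and>
           d s \<le> Min {delta q1 q2 (d i) |i. i \<in> {1..r} \<and> \<not> q1 dvd d i})))"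
proof -
  obtain G where I: "ideal_generated (xymonom ` G) = I" and D: "wdeg q1 q2 ` G = d ` {1..r}"
    using assms(7) unfolding minimally_generated_in_degrees_def minimal_monomial_generators_def
    by blast
  define \<Delta> where "\<Delta> = {delta q1 q2 (d i) |i. i \<in> {1..r} \<and> \<not> q1 dvd d i}"
  have fin: "finite \<Delta>" unfolding \<Delta>_def by simp
  have "lexicographic_ideal q1 q2 I \<longleftrightarrow>
      (\<forall>n \<in> wdeg q1 q2 ` G. \<not> q1 dvd n \<longrightarrow>
        (\<exists>n' \<in> wdeg q1 q2 ` G. q1 dvd n' \<and> n' \<le> delta q1 q2 n))"
    using assms I D by (intro lexicographic_iff_delta_bounds) auto
  then have lex: "lexicographic_ideal q1 q2 I \<longleftrightarrow> (\<forall>\<delta>\<in>\<Delta>. \<exists>s\<in>{1..r}. q1 dvd d s \<and> d s \<le> \<delta>)"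
    unfolding D \<Delta>_def by blast
  show ?thesis
  proof (cases "q1 dvd d 1")
    case True
    have "d 1 \<le> \<delta>" if \<delta>: "\<delta> \<in> \<Delta>" for \<delta>
    proof -
      obtain i where i: "i \<in> {1..r}" "\<delta> = delta q1 q2 (d i)"
        using \<delta> unfolding \<Delta>_def by blast
      then have "d i \<in> wdeg q1 q2 ` G" using D by blast
      then have "d i \<le> \<delta>" using delta_wdeg_props(2)[OF assms(1)] i(2) by auto
      moreover have "d 1 \<le> d i"
        using strict_mono_on_leD[OF assms(6)] i(1) by simp
      ultimately show ?thesis by simp
    qed
    with lex True \<open>1 \<le> r\<close> show ?thesis by force
  next
    case False
    then have "\<Delta> \<noteq> {}" using \<open>1 \<le> r\<close> by (auto simp: \<Delta>_def)
    \<comment> \<open>The degree that serves the least \<open>\<delta>\<close> serves all of them.\<close>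
    have "lexicographic_ideal q1 q2 I \<longleftrightarrow> (\<exists>s\<in>{1..r}. q1 dvd d s \<and> d s \<le> Min \<Delta>)"
      unfolding lex using fin \<open>\<Delta> \<noteq> {}\<close> by (meson Min_in Min_le order_trans)
    also have "\<dots> \<longleftrightarrow> (\<exists>s. 1 < s \<and> s \<le> r \<and> q1 dvd d s \<and> d s \<le> Min \<Delta>)"
      using False by (metis atLeastAtMost_iff le_neq_implies_less less_imp_le)
    finally show ?thesis using False unfolding \<Delta>_def by blast
  qed
qed

end
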